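(* Let $(X,\mathcal{F}_X)$ be a stratified space and let $A$ be a subspace of $X$. \begin{enumerate} \item If the space $X$ is normal, then $\mathrm{Whcat}(X,A,\mathcal{F}_X)\leq \mathrm{Ocat}(X,A,\mathcal{F}_X)$. \item If $B$ is a subset of $X$ and $A$ is a $B$-SND, then $\mathrm{Ocat}(X,B,\mathcal{F}_X)\leq \mathrm{Whcat}(X,A,\mathcal{F}_X)$. \end{enumerate}
   Context: A stratified space $(X,\mathcal{F}_X)$ is a topological space $X$ together with a partition $\mathcal{F}_X$ of $X$ whose elements (called strata) are path-connected subspaces of $X$. A stratified map between spaces with partitions is a continuous map sending any two points of a common stratum of the source to points of a common stratum of the target. The product $(X,\mathcal{F}_X)\times(Y,\mathcal{F}_Y)$ has as strata the products $S\times S'$ of strata. The interval $I=[0,1]$ carries the trivial partition $\mathcal{F}_I=\{[0,1]\}$. If $U\subseteq X$ is a subspace, the induced stratification $\mathcal{F}_U$ has for strata the connected components of the intersections $U\cap S$, $S\in\mathcal{F}_X$. Two stratified maps $f,g\colon (X,\mathcal{F}_X)\to (Y,\mathcal{F}_Y)$ are $\mathcal{S}$-homotopic if there is a stratified map $H\colon (X,\mathcal{F}_X)\times (I,\mathcal{F}_I)\to (Y,\mathcal{F}_Y)$ with $f=H(-,0)$ and $g=H(-,1)$. Whitehead category. The $i$th fat wedge $T_i(X,A)$ is the subset of $X^{i+1}$ of elements $(x_1,\ldots,x_{i+1})$ such that there exists $k$, $1\le k\le i+1$, with $x_k\in A$. It is endowed with the stratification induced from the product $(X,\mathcal{F}_X)^{i+1}$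 and denoted $T_i(X,A,\mathcal{F}_X)$. $\mathrm{Whcat}(X,A,\mathcal{F}_X)$ is the least integer $n\ge 0$ such that the diagonal $\Delta\colon(X,\mathcal{F}_X)\to(X,\mathcal{F}_X)^{n+1}$ factors up to $\mathcal{S}$-homotopy through the inclusion $t_n\colon T_n(X,A,\mathcal{F}_X)\to(X,\mathcal{F}_X)^{n+1}$, i.e. there is a stratified map $r\colon(X,\mathcal{F}_X)\to T_n(X,A,\mathcal{F}_X)$ with $t_n\circ r$ $\mathcal{S}$-homotopic to $\Delta$ ($\infty$ if there is none). Open category. A non-empty subset $U$ of $X$ is $A$-categorical if there is a stratified map $H\colon (U,\mathcal{F}_U)\times (I,\mathcal{F}_I)\to (X,\mathcal{F}_X)$ such that $H(x,0)=x$ and $H(x,1)\in A$ for all $x\in U$. $\mathrm{Ocat}(X,A,\mathcal{F}_X)$ is the least integer $n\ge 0$ such that $X$ is covered by $n+1$ open sets which are $A$-categorical ($\infty$ if there is no such covering). For subsets $A,B$ of $X$, $A$ is a $B$ stratified neighborhood deformation ($B$-SND) if $A$ has some open neighborhood in $X$ which is a $B$-categorical set. *)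

theory Defs
  imports "HOL-Analysis.Analysis" "HOL-Library.Extended_Nat" "HOL-Library.Disjoint_Sets"
begin

definition stratified_space :: "'a topology \<Rightarrow> 'a set set \<Rightarrow> bool" where
  "stratified_space X F \<longleftrightarrow> partition_on (topspace X) F \<and> (\<forall>S\<in>F. path_connectedin X S)"

definition stratified_map ::
    "'a topology \<Rightarrow> 'a set set \<Rightarrow> 'b topology \<Rightarrow> 'b set set \<Rightarrow> ('a \<Rightarrow> 'b) \<Rightarrow> bool" where
  "stratified_map X F Y G f \<longleftrightarrow>
     continuous_map X Y f \<and> (\<forall>S\<in>F. \<forall>x\<in>S. \<forall>y\<in>S. \<exists>T\<in>G. f x \<in> T \<and> f y \<in> T)"

definition prod_strata :: "'a set set \<Rightarrow> 'b set set \<Rightarrow> ('a \<times> 'b) set set" where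
  "prod_strata F G = {S \<times> T |S T. S \<in> F \<and> T \<in> G}"

definition induced_strata :: "'a topology \<Rightarrow> 'a set set \<Rightarrow> 'a set \<Rightarrow> 'a set set" where
  "induced_strata X F U = (\<Union>S\<in>F. connected_components_of (subtopology X (U \<inter> S)))"

abbreviation unit_interval :: "real topology" where
  "unit_interval \<equiv> top_of_set {0..1}"

abbreviation unit_interval_strata :: "real set set" where
  "unit_interval_strata \<equiv> {{0..1}}"

definition S_homotopic ::
    "'a topology \<Rightarrow> 'a set set \<Rightarrow> 'b topology \<Rightarrow> 'b set set \<Rightarrow> ('a \<Rightarrow> 'b) \<Rightarrow> ('a \<Rightarrow> 'b) \<Rightarrow> bool" where
  "S_homotopic X F Y G f g \<longleftrightarrow>
     stratified_map X F Y G f \<and> stratified_map X F Y G g \<and>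
     (\<exists>H. stratified_map (prod_topology X unit_interval) (prod_strata F unit_interval_strata) Y G H \<and>
          (\<forall>x\<in>topspace X. H (x, 0) = f x \<and> H (x, 1) = g x))"

text \<open>The power \<open>X\<close> to the \<open>n + 1\<close> consists of the extensional functions on the
  index set \<open>{..n}\<close>, so coordinates are numbered from 0 to \<open>n\<close>.\<close>

definition power_space :: "'a topology \<Rightarrow> nat \<Rightarrow> (nat \<Rightarrow> 'a) topology" where
  "power_space X n = product_topology (\<lambda>_. X) {..n}"

definition power_strata :: "'a set set \<Rightarrow> nat \<Rightarrow> (nat \<Rightarrow> 'a) set set" where
  "power_strata F n = {PiE {..n} S |S. \<forall>i\<le>n. S i \<in> F}"

definition diagonal_map :: "nat \<Rightarrow> 'a \<Rightarrow> nat \<Rightarrow> 'a" where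
  "diagonal_map n x = (\<lambda>i\<in>{..n}. x)"

definition fat_wedge :: "'a topology \<Rightarrow> 'a set \<Rightarrow> nat \<Rightarrow> (nat \<Rightarrow> 'a) set" where
  "fat_wedge X A n = {x \<in> topspace (power_space X n). \<exists>k\<le>n. x k \<in> A}"

definition fat_wedge_space :: "'a topology \<Rightarrow> 'a set \<Rightarrow> nat \<Rightarrow> (nat \<Rightarrow> 'a) topology" where
  "fat_wedge_space X A n = subtopology (power_space X n) (fat_wedge X A n)"

definition fat_wedge_strata ::
    "'a topology \<Rightarrow> 'a set \<Rightarrow> 'a set set \<Rightarrow> nat \<Rightarrow> (nat \<Rightarrow> 'a) set set" where
  "fat_wedge_strata X A F n =
     induced_strata (power_space X n) (power_strata F n) (fat_wedge X A n)"

text \<open>The infimum of the empty set in \<^typ>\<open>enat\<close> is \<open>\<infinity>\<close>. In \<open>Whcat\<close>, composing \<open>r\<close> with the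
  inclusion of the fat wedge does not change the underlying function.\<close>

definition Whcat :: "'a topology \<Rightarrow> 'a set \<Rightarrow> 'a set set \<Rightarrow> enat" where
  "Whcat X A F = Inf (enat ` {n.
     \<exists>r. stratified_map X F (fat_wedge_space X A n) (fat_wedge_strata X A F n) r \<and>
         S_homotopic X F (power_space X n) (power_strata F n) r (diagonal_map n)})"

definition categorical :: "'a topology \<Rightarrow> 'a set \<Rightarrow> 'a set set \<Rightarrow> 'a set \<Rightarrow> bool" where
  "categorical X A F U \<longleftrightarrow>
     U \<noteq> {} \<and> U \<subseteq> topspace X \<and>
     (\<exists>H. stratified_map
            (prod_topology (subtopology X U) unit_interval)
            (prod_strata (induced_strata X F U) unit_interval_strata) X F H \<and>
          (\<forall>x\<in>U. H (x, 0) = x \<and> H (x, 1) \<in> A))"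

text \<open>The \<open>n + 1\<close> covering sets form an indexed family, so repetitions are allowed.\<close>

definition Ocat :: "'a topology \<Rightarrow> 'a set \<Rightarrow> 'a set set \<Rightarrow> enat" where
  "Ocat X A F = Inf (enat ` {n.
     \<exists>U :: nat \<Rightarrow> 'a set. (\<forall>i\<le>n. openin X (U i) \<and> categorical X A F (U i)) \<and>
         topspace X = (\<Union>i\<le>n. U i)})"

definition stratified_neighborhood_deformation ::
    "'a topology \<Rightarrow> 'a set \<Rightarrow> 'a set set \<Rightarrow> 'a set \<Rightarrow> bool" where
  "stratified_neighborhood_deformation X B F A \<longleftrightarrow>
     (\<exists>U. openin X U \<and> A \<subseteq> U \<and> categorical X B F U)"

end

theory Submission
  imports Defs
begin

text \<open>
  Both inequalities compare the same kind of object: homotopies that start at the identity and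
  move every point inside its own stratum. The first step is to see that the two invariants are
  defined by such homotopies. For a categorical set this holds because a stratified
  homotopy sends the track \<open>{x} \<times> [0,1]\<close> into a single stratum, which must be the stratum of
  \<open>x\<close> itself (\<open>categorical_iff_deformation\<close>). Likewise a stratified homotopy between a map
  \<open>r\<close> into the fat wedge and the diagonal, run backwards and read coordinate by coordinate, is a
  family of \<open>n + 1\<close> such deformations of the whole of \<open>X\<close>, subject to the condition that each
  point is carried into \<open>A\<close> by at least one of them (\<open>whitehead_iff_deformations\<close>). In the
  converse direction \<open>r\<close> has to send a stratum \<open>S\<close> into one connected component of the
  fat wedge intersected with \<open>S\<close> to the power \<open>n + 1\<close>; it does, since \<open>S\<close> is path-connected.

  After this translation the theorem is the comparison of two ways of spreading a deformation
  into \<open>A\<close> over \<open>X\<close>. Given a categorical cover of a normal space, shrink it to a closed cover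
  and slow each deformation down by a Urysohn function, so that it keeps its end point on the
  closed set and stands still near the complement of the open set; it then extends to \<open>X\<close>
  (\<open>extend_deformation_from_closed\<close>). Conversely, given deformations \<open>G\<^sub>i\<close> of \<open>X\<close> and a
  neighbourhood \<open>U\<close> of \<open>A\<close> that deforms into \<open>B\<close>, the sets of points that \<open>G\<^sub>i\<close> carries into
  \<open>U\<close> form an open cover, and each of them deforms into \<open>B\<close> by following first \<open>G\<^sub>i\<close> and then the
  deformation of \<open>U\<close> (\<open>concatenate_deformations\<close>).
\<close>

section \<open>Deformations inside the strata\<close>

text \<open>The last condition speaks of points and strata of \<open>F\<close> only, and not of the connected
  components of \<open>U \<inter> S\<close>; this is what makes such deformations easy to restrict, slow down and
  concatenate.\<close>

definition stratum_preserving_deformation ::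
    "'a topology \<Rightarrow> 'a set set \<Rightarrow> 'a set \<Rightarrow> ('a \<times> real \<Rightarrow> 'a) \<Rightarrow> bool" where
  "stratum_preserving_deformation X F U H \<longleftrightarrow>
     continuous_map (prod_topology (subtopology X U) unit_interval) X H \<and>
     (\<forall>x\<in>U. H (x, 0) = x) \<and>
     (\<forall>S\<in>F. \<forall>x\<in>U \<inter> S. \<forall>t\<in>{0..1}. H (x, t) \<in> S)"

lemma stratum_preserving_deformationD:
  assumes "stratum_preserving_deformation X F U H"
  shows "continuous_map (prod_topology (subtopology X U) unit_interval) X H"
    and "\<And>x. x \<in> U \<Longrightarrow> H (x, 0) = x"
    and "\<And>S x t. S \<in> F \<Longrightarrow> x \<in> U \<Longrightarrow> x \<in> S \<Longrightarrow> 0 \<le> t \<Longrightarrow> t \<le> 1 \<Longrightarrow> H (x, t) \<in> S"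
  using assms by (auto simp: stratum_preserving_deformation_def)

lemma partition_on_same_part:
  assumes "partition_on A P" "S \<in> P" "x \<in> S" "T \<in> P" "x \<in> T"
  shows "T = S"
  using disjointD[OF partition_onD2[OF assms(1)] assms(4,2)] assms(3,5) by auto

lemma stratified_map_common_stratum:
  assumes "stratified_map X F Y G f" "S \<in> F" "x \<in> S" "y \<in> S"
  obtains T where "T \<in> G" "f x \<in> T" "f y \<in> T"
  using assms unfolding stratified_map_def by metis

lemma stratified_mapI:
  assumes "continuous_map X Y f" "\<And>S. S \<in> F \<Longrightarrow> \<exists>T\<in>G. f ` S \<subseteq> T"
  shows "stratified_map X F Y G f"
  unfolding stratified_map_def using assms by (meson image_subset_iff)

lemma continuous_map_homotopy_along:
  assumes "continuous_map (prod_topology Y unit_interval) X H"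
    and "continuous_map Z Y f" and "continuous_map Z euclideanreal s"
    and "\<And>z. z \<in> topspace Z \<Longrightarrow> s z \<in> {0..1}"
  shows "continuous_map Z X (\<lambda>z. H (f z, s z))"
proof -
  have "continuous_map Z (prod_topology Y unit_interval) (\<lambda>z. (f z, s z))"
    using assms(2-4) by (intro continuous_map_pairedI continuous_map_into_subtopology) auto
  from continuous_map_compose[OF this assms(1)] show ?thesis
    by (simp add: o_def)
qed

lemma continuous_map_time: "continuous_map (prod_topology Y unit_interval) euclideanreal snd"
  using continuous_map_snd continuous_map_into_fulltopology by blast

text \<open>A point \<open>x\<close> of \<open>U \<inter> S\<close> lies in some component \<open>C\<close> of \<open>U \<inter> S\<close>, so a stratified homotopy
  sends \<open>C \<times> [0,1]\<close> into one stratum; as the homotopy starts at \<open>x\<close>, that stratum is \<open>S\<close>.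
  Conversely, \<open>C \<subseteq> S\<close> is all that is needed for a deformation inside the strata to be
  stratified.\<close>

lemma categorical_iff_deformation:
  assumes F: "partition_on (topspace X) F"
  shows "categorical X A F U \<longleftrightarrow>
     U \<noteq> {} \<and> U \<subseteq> topspace X \<and>
     (\<exists>H. stratum_preserving_deformation X F U H \<and> (\<forall>x\<in>U. H (x, 1) \<in> A))"
    (is "_ \<longleftrightarrow> ?rhs")
proof
  assume L: "categorical X A F U"
  then obtain H where U: "U \<noteq> {}" "U \<subseteq> topspace X"
    and H: "stratified_map (prod_topology (subtopology X U) unit_interval)
            (prod_strata (induced_strata X F U) unit_interval_strata) X F H"
    and H01: "\<And>x. x \<in> U \<Longrightarrow> H (x, 0) = x \<and> H (x, 1) \<in> A"
    unfolding categorical_def by blast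
  have "H (x, t) \<in> S" if S: "S \<in> F" and x: "x \<in> U" "x \<in> S" and t: "t \<in> {0..1}" for S x t
  proof -
    define C where "C = connected_component_of_set (subtopology X (U \<inter> S)) x"
    have "x \<in> topspace (subtopology X (U \<inter> S))"
      using x U by auto
    then have "x \<in> C" "C \<in> connected_components_of (subtopology X (U \<inter> S))"
      by (auto simp: C_def connected_component_of_refl connected_components_of_def)
    then have "C \<times> {0..1} \<in> prod_strata (induced_strata X F U) unit_interval_strata"
      and "(x, 0) \<in> C \<times> {0..1::real}" "(x, t) \<in> C \<times> {0..1}"
      using S t by (auto simp: prod_strata_def induced_strata_def)
    then obtain T where "T \<in> F" "H (x, 0) \<in> T" "H (x, t) \<in> T"
      using stratified_map_common_stratum[OF H] by metis
    then show ?thesis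
      using partition_on_same_part[OF F S] x H01 by metis
  qed
  then have "stratum_preserving_deformation X F U H"
    using H H01 by (auto simp: stratum_preserving_deformation_def stratified_map_def)
  then show ?rhs
    using U H01 by auto
next
  assume ?rhs
  then obtain H where U: "U \<noteq> {}" "U \<subseteq> topspace X"
    and H: "stratum_preserving_deformation X F U H" and H1: "\<And>x. x \<in> U \<Longrightarrow> H (x, 1) \<in> A"
    by blast
  note HD = stratum_preserving_deformationD[OF H]
  have "stratified_map (prod_topology (subtopology X U) unit_interval)
            (prod_strata (induced_strata X F U) unit_interval_strata) X F H"
  proof (rule stratified_mapI[OF HD(1)])
    fix P assume "P \<in> prod_strata (induced_strata X F U) unit_interval_strata"
    then obtain S C where S: "S \<in> F" and C: "C \<in> connected_components_of (subtopology X (U \<inter> S))"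
      and P: "P = C \<times> {0..1}"
      by (auto simp: prod_strata_def induced_strata_def)
    have "C \<subseteq> U \<inter> S"
      using connected_components_of_subset[OF C] by auto
    then have "H ` P \<subseteq> S"
      using P S by (auto intro!: HD(3))
    with S show "\<exists>T\<in>F. H ` P \<subseteq> T" by blast
  qed
  then show "categorical X A F U"
    unfolding categorical_def using U HD(2) H1 by blast
qed

section \<open>The Whitehead condition in coordinates\<close>

text \<open>The homotopy in the Whitehead condition runs from \<open>r\<close> to the diagonal, while the deformations
  start at the identity: hence the reversal of time. The end points of the deformations are then
  the coordinates of \<open>r\<close>, and the fat wedge asks one of them to lie in \<open>A\<close>.\<close>

lemma whitehead_iff_deformations:
  assumes XF: "stratified_space X F"
  shows "(\<exists>r. stratified_map X F (fat_wedge_space X A n) (fat_wedge_strata X A F n) r \<and>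
         S_homotopic X F (power_space X n) (power_strata F n) r (diagonal_map n)) \<longleftrightarrow>
     (\<exists>G. (\<forall>i\<le>n. stratum_preserving_deformation X F (topspace X) (G i)) \<and>
          (\<forall>x\<in>topspace X. \<exists>k\<le>n. G k (x, 1) \<in> A))"
    (is "?lhs \<longleftrightarrow> ?rhs")
proof
  have F: "partition_on (topspace X) F"
    using XF by (simp add: stratified_space_def)
  assume ?lhs
  then obtain r H where r: "stratified_map X F (fat_wedge_space X A n) (fat_wedge_strata X A F n) r"
    and H: "stratified_map (prod_topology X unit_interval) (prod_strata F unit_interval_strata)
               (power_space X n) (power_strata F n) H"
    and H01: "\<And>x. x \<in> topspace X \<Longrightarrow> H (x, 0) = r x \<and> H (x, 1) = diagonal_map n x"
    unfolding S_homotopic_def by blast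
  define G where "G = (\<lambda>i p. H (fst p, 1 - snd p) i)"
  have "stratum_preserving_deformation X F (topspace X) (G i)" if i: "i \<le> n" for i
    unfolding stratum_preserving_deformation_def
  proof (intro conjI ballI)
    have "continuous_map (prod_topology X unit_interval) (power_space X n) H"
      using H by (simp add: stratified_map_def)
    then have "continuous_map (prod_topology X unit_interval) (power_space X n)
        (\<lambda>p. H (fst p, 1 - snd p))"
      by (rule continuous_map_homotopy_along)
         (auto intro!: continuous_intros continuous_map_time)
    moreover have "continuous_map (power_space X n) X (\<lambda>z. z i)"
      using i by (auto simp: power_space_def intro: continuous_map_product_projection)
    ultimately show "continuous_map (prod_topology (subtopology X (topspace X)) unit_interval) X (G i)"
      unfolding G_def using continuous_map_compose[unfolded o_def] by fastforce
  next
    fix x assume "x \<in> topspace X"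
    then show "G i (x, 0) = x"
      using H01 i by (simp add: G_def diagonal_map_def)
  next
    fix S x and t :: real
    assume S: "S \<in> F" and x: "x \<in> topspace X \<inter> S" and t: "t \<in> {0..1}"
    have "S \<times> {0..1} \<in> prod_strata F unit_interval_strata"
      "(x, 1) \<in> S \<times> {0..1::real}" "(x, 1 - t) \<in> S \<times> {0..1}"
      using S x t by (auto simp: prod_strata_def)
    then obtain P where "P \<in> power_strata F n" "H (x, 1) \<in> P" "H (x, 1 - t) \<in> P"
      using stratified_map_common_stratum[OF H] by metis
    then obtain T where T: "T i \<in> F" "H (x, 1) i \<in> T i" "H (x, 1 - t) i \<in> T i"
      using i by (auto simp: power_strata_def PiE_iff)
    moreover have "H (x, 1) i = x"
      using H01 x i by (simp add: diagonal_map_def)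
    ultimately have "T i = S"
      using partition_on_same_part[OF F S] x by auto
    with T show "G i (x, t) \<in> S" by (simp add: G_def)
  qed
  moreover have "\<exists>k\<le>n. G k (x, 1) \<in> A" if x: "x \<in> topspace X" for x
  proof -
    have "continuous_map X (fat_wedge_space X A n) r"
      using r by (simp add: stratified_map_def)
    then have "r x \<in> fat_wedge X A n"
      using x by (auto simp: fat_wedge_space_def continuous_map_in_subtopology)
    then show ?thesis
      using H01 x by (auto simp: G_def fat_wedge_def)
  qed
  ultimately show ?rhs by (intro exI[of _ G] conjI allI ballI impI)
next
  have F: "partition_on (topspace X) F" and Fc: "\<And>S. S \<in> F \<Longrightarrow> path_connectedin X S"
    using XF by (auto simp: stratified_space_def)
  have FX: "\<And>S. S \<in> F \<Longrightarrow> S \<subseteq> topspace X"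
    using F partition_onD1 by blast
  assume ?rhs
  then obtain G where G: "\<And>i. i \<le> n \<Longrightarrow> stratum_preserving_deformation X F (topspace X) (G i)"
    and GA: "\<And>x. x \<in> topspace X \<Longrightarrow> \<exists>k\<le>n. G k (x, 1) \<in> A"
    by blast
  note GD = stratum_preserving_deformationD[OF G]
  define H where "H = (\<lambda>p. \<lambda>i\<in>{..n}. G i (fst p, 1 - snd p))"
  define r where "r = (\<lambda>x. H (x, 0))"
  have H1: "H (x, 1) = diagonal_map n x" if "x \<in> topspace X" for x
    using GD(2) that by (auto simp: H_def diagonal_map_def)
  have conH: "continuous_map (prod_topology X unit_interval) (power_space X n) H"
    unfolding power_space_def H_def
  proof (rule continuous_map_componentwise[THEN iffD2], intro conjI ballI)
    fix i assume i: "i \<in> {..n}"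
    have "continuous_map (prod_topology X unit_interval) X (G i)"
      using GD(1)[of i] i by simp
    then have "continuous_map (prod_topology X unit_interval) X (\<lambda>p. G i (fst p, 1 - snd p))"
      by (rule continuous_map_homotopy_along)
         (auto intro!: continuous_intros continuous_map_time)
    with i show "continuous_map (prod_topology X unit_interval) X
        (\<lambda>p. (\<lambda>i\<in>{..n}. G i (fst p, 1 - snd p)) i)"
      by simp
  qed auto
  have HS: "H (x, t) \<in> PiE {..n} (\<lambda>_. S)" if "S \<in> F" "x \<in> S" "t \<in> {0..1}" for S x t
    using that FX by (auto simp: H_def intro!: GD(3))
  have conslice: "continuous_map X (power_space X n) (\<lambda>x. H (x, t))" if "t \<in> {0..1}" for t
    using that by (intro continuous_map_homotopy_along[OF conH]) auto
  have power: "PiE {..n} (\<lambda>_. S) \<in> power_strata F n" if "S \<in> F" for S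
    using that by (auto simp: power_strata_def)
  have slice: "stratified_map X F (power_space X n) (power_strata F n) (\<lambda>x. H (x, t))"
    if "t \<in> {0..1}" for t
  proof (rule stratified_mapI[OF conslice[OF that]])
    fix S assume S: "S \<in> F"
    then have "(\<lambda>x. H (x, t)) ` S \<subseteq> PiE {..n} (\<lambda>_. S)"
      using HS that by (intro image_subsetI) simp
    with power[OF S] show "\<exists>T\<in>power_strata F n. (\<lambda>x. H (x, t)) ` S \<subseteq> T" ..
  qed
  have "stratified_map X F (power_space X n) (power_strata F n) r"
    using slice[of 0] by (simp add: r_def)
  moreover have "stratified_map X F (power_space X n) (power_strata F n) (diagonal_map n)"
  proof (rule stratified_mapI)
    show "continuous_map X (power_space X n) (diagonal_map n)"
      using continuous_map_eq[OF conslice[of 1]] H1 by simp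
    fix S assume S: "S \<in> F"
    have "diagonal_map n ` S \<subseteq> PiE {..n} (\<lambda>_. S)"
      by (auto simp: diagonal_map_def split: if_splits)
    with power[OF S] show "\<exists>T\<in>power_strata F n. diagonal_map n ` S \<subseteq> T" ..
  qed
  moreover have "stratified_map (prod_topology X unit_interval) (prod_strata F unit_interval_strata)
               (power_space X n) (power_strata F n) H"
  proof (rule stratified_mapI[OF conH])
    fix P assume "P \<in> prod_strata F unit_interval_strata"
    then obtain S where S: "S \<in> F" "P = S \<times> {0..1}"
      by (auto simp: prod_strata_def)
    then have "H ` P \<subseteq> PiE {..n} (\<lambda>_. S)"
      using HS by (intro image_subsetI) (metis mem_Sigma_iff prod.collapse)
    with power[OF S(1)] show "\<exists>T\<in>power_strata F n. H ` P \<subseteq> T" ..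
  qed
  ultimately have "S_homotopic X F (power_space X n) (power_strata F n) r (diagonal_map n)"
    unfolding S_homotopic_def using H1 by (auto simp: r_def)
  moreover have "stratified_map X F (fat_wedge_space X A n) (fat_wedge_strata X A F n) r"
  proof (rule stratified_mapI)
    have conr: "continuous_map X (power_space X n) r"
      using conslice[of 0] by (simp add: r_def)
    have rA: "r x \<in> fat_wedge X A n" if "x \<in> topspace X" for x
      using GA[OF that] that continuous_map_image_subset_topspace[OF conr]
      by (auto simp: fat_wedge_def r_def H_def)
    show "continuous_map X (fat_wedge_space X A n) r"
      unfolding fat_wedge_space_def using conr rA by (auto intro: continuous_map_into_subtopology)
    fix S assume S: "S \<in> F"
    then obtain x where x: "x \<in> S"
      using F partition_onD3 by fastforce
    \<comment> \<open>Strata of the fat wedge are connected components, so here connectedness of \<open>S\<close> is used.\<close>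
    let ?W = "fat_wedge X A n \<inter> PiE {..n} (\<lambda>_. S)"
    have "r ` S \<subseteq> ?W"
      using rA HS[OF S, of _ 0] FX[OF S] by (auto simp: r_def)
    moreover have "connectedin (power_space X n) (r ` S)"
      using connectedin_continuous_map_image[OF conr path_connectedin_imp_connectedin[OF Fc[OF S]]] .
    ultimately have con: "connectedin (subtopology (power_space X n) ?W) (r ` S)"
      by (simp add: connectedin_subtopology)
    let ?C = "connected_component_of_set (subtopology (power_space X n) ?W) (r x)"
    have "r ` S \<subseteq> ?C"
      using con x by (intro connected_component_of_maximal) auto
    moreover have "?C \<in> connected_components_of (subtopology (power_space X n) ?W)"
      using connectedin_subset_topspace[OF con] x
      by (simp add: connected_component_in_connected_components_of image_subset_iff)
    then have "?C \<in> fat_wedge_strata X A F n"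
      unfolding fat_wedge_strata_def induced_strata_def using power[OF S] by blast
    ultimately show "\<exists>T\<in>fat_wedge_strata X A F n. r ` S \<subseteq> T"
      by blast
  qed
  ultimately show ?lhs by (intro exI[of _ r] conjI)
qed

section \<open>From a categorical cover to the fat wedge\<close>

text \<open>The part of \<open>K\<close> missed by all but the last open set is closed, so normality yields an open
  \<open>V\<close> around it whose closure lies in the last set; what remains of \<open>K\<close> outside \<open>V\<close> is covered
  by the other sets. An arbitrary closed \<open>K\<close> in place of the whole space makes this an
  induction.\<close>

lemma normal_space_shrink_finite_cover:
  assumes X: "normal_space X" and "closedin X K"
    and "\<And>i. i < n \<Longrightarrow> openin X (U i)" and "K \<subseteq> (\<Union>i<n. U i)"
  shows "\<exists>C. (\<forall>i<(n::nat). closedin X (C i) \<and> C i \<subseteq> U i) \<and> K \<subseteq> (\<Union>i<n. C i)"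
  using assms(2-4)
proof (induction n arbitrary: K)
  case 0
  then show ?case by auto
next
  case (Suc n)
  have "closedin X (K - (\<Union>i<n. U i))"
    using Suc.prems by (intro closedin_diff openin_Union) auto
  moreover have "K - (\<Union>i<n. U i) \<subseteq> U n"
    using Suc.prems(3) by (auto simp: lessThan_Suc)
  ultimately obtain V where V: "openin X V" "K - (\<Union>i<n. U i) \<subseteq> V" "X closure_of V \<subseteq> U n"
    using normal_space_alt[THEN iffD1, OF X, rule_format, of _ "U n"] Suc.prems(2)[of n]
    by (metis lessI)
  have "closedin X (K - V)" "K - V \<subseteq> (\<Union>i<n. U i)"
    using Suc.prems(1) V by auto
  then obtain C where C: "\<forall>i<n. closedin X (C i) \<and> C i \<subseteq> U i" "K - V \<subseteq> (\<Union>i<n. C i)"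
    using Suc.IH[of "K - V"] Suc.prems(2) by auto
  have "V \<subseteq> X closure_of V"
    using V(1) by (simp add: closure_of_subset openin_subset)
  then have "K \<subseteq> (\<Union>i<Suc n. (C(n := X closure_of V)) i)"
    using C(2) by (fastforce simp: lessThan_Suc)
  moreover have "\<forall>i<Suc n. closedin X ((C(n := X closure_of V)) i) \<and> (C(n := X closure_of V)) i \<subseteq> U i"
    using C(1) V(3) by (auto simp: less_Suc_eq)
  ultimately show ?case by (intro exI[of _ "C(n := X closure_of V)"] conjI)
qed

text \<open>A Urysohn function with values in \<open>[-1,1]\<close>, equal to 1 on \<open>C\<close> and to -1 outside \<open>U\<close>,
  serves as the speed of the deformation wherever it is nonnegative, and points with a negative
  value stay fixed. The set where it is nonnegative is closed in \<open>X\<close> and contained in \<open>U\<close>, so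
  the slowed deformation and the constant one are glued along closed sets. A speed that merely
  vanishes outside \<open>U\<close> would not do: \<open>H\<close> need not extend continuously to the boundary of \<open>U\<close>,
  so \<open>H (x, t)\<close> can stay away from \<open>x\<close> as \<open>x\<close> tends to a boundary point and \<open>t\<close> to 0.\<close>

lemma extend_deformation_from_closed:
  assumes X: "normal_space X" and FX: "\<Union>F \<subseteq> topspace X" and U: "openin X U"
    and C: "closedin X C" "C \<subseteq> U"
    and H: "stratum_preserving_deformation X F U H"
  shows "\<exists>G. stratum_preserving_deformation X F (topspace X) G \<and> (\<forall>x\<in>C. G (x, 1) = H (x, 1))"
proof -
  note HD = stratum_preserving_deformationD[OF H]
  have "closedin X (topspace X - U)" "disjnt (topspace X - U) C"
    using U C by (auto simp: disjnt_def)
  then obtain l where l: "continuous_map X (top_of_set {-1..1::real}) l"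
    "l ` (topspace X - U) \<subseteq> {-1}" "l ` C \<subseteq> {1}"
    using Urysohn_lemma[OF X _ C(1), of "topspace X - U" "-1" 1] by auto
  have conl: "continuous_map X euclideanreal l" and l1: "\<And>x. x \<in> topspace X \<Longrightarrow> l x \<le> 1"
    using l(1) by (auto simp: continuous_map_in_subtopology)
  have lU: "x \<in> U" if "x \<in> topspace X" "0 \<le> l x" for x
    using l(2) that by force
  let ?Z = "prod_topology X unit_interval"
  define G where "G = (\<lambda>p. if 0 \<le> l (fst p) then H (fst p, snd p * l (fst p)) else fst p)"
  have conlf: "continuous_map ?Z euclideanreal (\<lambda>p. l (fst p))"
    using continuous_map_compose[OF continuous_map_fst conl] by (simp add: o_def)
  have "continuous_map ?Z X G"
    unfolding G_def
  proof (rule continuous_map_cases_le)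
    let ?P = "subtopology ?Z {p \<in> topspace ?Z. 0 \<le> l (fst p)}"
    show "continuous_map ?P X (\<lambda>p. H (fst p, snd p * l (fst p)))"
    proof (rule continuous_map_homotopy_along[OF HD(1)])
      show "continuous_map ?P (subtopology X U) fst"
        using lU by (intro continuous_map_into_subtopology
            continuous_map_from_subtopology[OF continuous_map_fst]) auto
      show "continuous_map ?P euclideanreal (\<lambda>p. snd p * l (fst p))"
        by (intro continuous_map_real_mult continuous_map_from_subtopology conlf continuous_map_time)
      show "\<And>p. p \<in> topspace ?P \<Longrightarrow> snd p * l (fst p) \<in> {0..1}"
        using l1 by (auto intro: mult_le_one)
    qed
    show "H (fst p, snd p * l (fst p)) = fst p" if "p \<in> topspace ?Z" "0 = l (fst p)" for p
      using that HD(2) lU by (metis mem_Times_iff mult_zero_right order_refl topspace_prod_topology)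
  qed (auto intro: conlf continuous_map_from_subtopology continuous_map_fst)
  moreover have "G (x, t) \<in> S" if "S \<in> F" "x \<in> S" "t \<in> {0..1}" for S x t
    using that FX l1 lU by (auto simp: G_def intro!: HD(3) mult_le_one)
  ultimately have "stratum_preserving_deformation X F (topspace X) G"
    using HD(2) lU by (auto simp: stratum_preserving_deformation_def G_def)
  moreover have "G (x, 1) = H (x, 1)" if "x \<in> C" for x
    using that l(3) by (auto simp: G_def)
  ultimately show ?thesis by (intro exI[of _ G] conjI ballI)
qed

section \<open>From the fat wedge to a categorical cover\<close>

text \<open>The domain consists of the points that reach \<open>U\<close> at time 1, so that the second deformation
  can take over there. Each of the two stays in the stratum of the starting point, hence so does
  their concatenation.\<close>

lemma concatenate_deformations:
  assumes G: "stratum_preserving_deformation X F (topspace X) G"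
    and K: "stratum_preserving_deformation X F U K"
  shows "\<exists>D. stratum_preserving_deformation X F {x \<in> topspace X. G (x, 1) \<in> U} D \<and>
             (\<forall>x. D (x, 1) = K (G (x, 1), 1))"
proof -
  note GD = stratum_preserving_deformationD[OF G]
  note KD = stratum_preserving_deformationD[OF K]
  let ?W = "{x \<in> topspace X. G (x, 1) \<in> U}"
  let ?Z = "prod_topology (subtopology X ?W) unit_interval"
  define D where "D = (\<lambda>p. if snd p \<le> 1/2 then G (fst p, 2 * snd p)
                            else K (G (fst p, 1), 2 * snd p - 1))"
  have fstX: "continuous_map ?Z (subtopology X (topspace X)) fst"
    using continuous_map_into_fulltopology[OF continuous_map_fst] by auto
  have G1: "continuous_map ?Z X (\<lambda>p. G (fst p, 1))"
    by (intro continuous_map_homotopy_along[OF GD(1)] fstX) auto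
  have "continuous_map ?Z X D"
    unfolding D_def
  proof (rule continuous_map_cases_le)
    let ?P = "subtopology ?Z {p \<in> topspace ?Z. snd p \<le> 1/2}"
    let ?Q = "subtopology ?Z {p \<in> topspace ?Z. 1/2 \<le> snd p}"
    show "continuous_map ?P X (\<lambda>p. G (fst p, 2 * snd p))"
      by (intro continuous_map_homotopy_along[OF GD(1)] continuous_map_from_subtopology[OF fstX]
            continuous_map_real_mult continuous_map_from_subtopology[OF continuous_map_time]) auto
    show "continuous_map ?Q X (\<lambda>p. K (G (fst p, 1), 2 * snd p - 1))"
      by (intro continuous_map_homotopy_along[OF KD(1)] continuous_map_into_subtopology
            continuous_map_from_subtopology[OF G1] continuous_map_diff
            continuous_map_real_mult continuous_map_from_subtopology[OF continuous_map_time]) auto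
    show "G (fst p, 2 * snd p) = K (G (fst p, 1), 2 * snd p - 1)"
      if p: "p \<in> topspace ?Z" "snd p = 1/2" for p
    proof -
      have "2 * snd p = 1" "G (fst p, 1) \<in> U"
        using p by auto
      then show ?thesis using KD(2) by simp
    qed
  qed (auto intro: continuous_map_time)
  moreover have "D (x, t) \<in> S" if S: "S \<in> F" "x \<in> S" and x: "x \<in> ?W" and t: "t \<in> {0..1}" for S x t
  proof (cases "t \<le> 1/2")
    case True
    then show ?thesis
      using that by (auto simp: D_def intro!: GD(3))
  next
    case False
    have "G (x, 1) \<in> S"
      using S x by (auto intro!: GD(3))
    with False show ?thesis
      using that by (auto simp: D_def intro!: KD(3))
  qed
  ultimately have "stratum_preserving_deformation X F ?W D"
    using GD(2) by (auto simp: stratum_preserving_deformation_def D_def)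
  moreover have "D (x, 1) = K (G (x, 1), 1)" for x
    by (simp add: D_def)
  ultimately show ?thesis by (intro exI[of _ D] conjI allI)
qed

theorem theorem3:
  fixes X :: "'a topology" and F :: "'a set set" and A :: "'a set"
  assumes "stratified_space X F" and "A \<subseteq> topspace X"
  shows "(normal_space X \<longrightarrow> Whcat X A F \<le> Ocat X A F) \<and>
    (\<forall>B. B \<subseteq> topspace X \<and> stratified_neighborhood_deformation X B F A
       \<longrightarrow> Ocat X B F \<le> Whcat X A F)"
proof (intro conjI impI allI)
  have F: "partition_on (topspace X) F"
    using assms(1) by (simp add: stratified_space_def)
  note categorical_iff = categorical_iff_deformation[OF F]
  note whitehead_iff = whitehead_iff_deformations[OF assms(1)]
  {
    assume X: "normal_space X"
    have "\<exists>G. (\<forall>i\<le>n. stratum_preserving_deformation X F (topspace X) (G i)) \<and>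
              (\<forall>x\<in>topspace X. \<exists>k\<le>n. G k (x, 1) \<in> A)"
      if U: "\<forall>i\<le>n. openin X (U i) \<and> categorical X A F (U i)"
        and cover: "topspace X = (\<Union>i\<le>n. U i)" for n and U :: "nat \<Rightarrow> 'a set"
    proof -
      obtain C where C: "\<And>i. i \<le> n \<Longrightarrow> closedin X (C i) \<and> C i \<subseteq> U i"
        and coverC: "topspace X \<subseteq> (\<Union>i\<le>n. C i)"
        using normal_space_shrink_finite_cover[OF X closedin_topspace, of "Suc n" U] U cover
        by (auto simp: less_Suc_eq_le lessThan_Suc_atMost)
      have "\<exists>G. stratum_preserving_deformation X F (topspace X) G \<and> (\<forall>x\<in>C i. G (x, 1) \<in> A)"
        if i: "i \<le> n" for i
      proof -
        obtain H where H: "stratum_preserving_deformation X F (U i) H" "\<forall>x\<in>U i. H (x, 1) \<in> A"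
          using U i categorical_iff by blast
        have "\<Union>F \<subseteq> topspace X"
          using F partition_onD1 by blast
        from extend_deformation_from_closed[OF X this _ _ _ H(1), of "C i"] show ?thesis
          using U C[OF i] i H(2) by (metis subsetD)
      qed
      then obtain G where "\<And>i. i \<le> n \<Longrightarrow> stratum_preserving_deformation X F (topspace X) (G i) \<and>
          (\<forall>x\<in>C i. G i (x, 1) \<in> A)"
        by metis
      then show ?thesis
        using coverC by (intro exI[of _ G]) blast
    qed
    then show "Whcat X A F \<le> Ocat X A F"
      unfolding Whcat_def Ocat_def whitehead_iff by (intro Inf_superset_mono image_mono) blast
  }
  {
    fix B assume "B \<subseteq> topspace X \<and> stratified_neighborhood_deformation X B F A"
    then obtain U K where U: "openin X U" "A \<subseteq> U" "U \<noteq> {}" "U \<subseteq> topspace X"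
      and K: "stratum_preserving_deformation X F U K" "\<And>x. x \<in> U \<Longrightarrow> K (x, 1) \<in> B"
      unfolding stratified_neighborhood_deformation_def categorical_iff by blast
    have "\<exists>V. (\<forall>i\<le>n. openin X (V i) \<and> categorical X B F (V i)) \<and> topspace X = (\<Union>i\<le>n. V i)"
      if G: "\<forall>i\<le>n. stratum_preserving_deformation X F (topspace X) (G i)"
        and GA: "\<forall>x\<in>topspace X. \<exists>k\<le>n. G k (x, 1) \<in> A" for n and G :: "nat \<Rightarrow> 'a \<times> real \<Rightarrow> 'a"
    proof -
      define W where "W i = {x \<in> topspace X. G i (x, 1) \<in> U}" for i
      have cover: "topspace X = (\<Union>i\<le>n. W i)"
        using GA U(2) by (fastforce simp: W_def)
      have opW: "openin X (W i)" if "i \<le> n" for i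
      proof -
        have "continuous_map (prod_topology X unit_interval) X (G i)"
          using G that by (simp add: stratum_preserving_deformation_def)
        then have "continuous_map X X (\<lambda>x. G i (x, 1))"
          by (rule continuous_map_homotopy_along) auto
        from openin_continuous_map_preimage[OF this U(1)] show ?thesis
          by (simp add: W_def)
      qed
      have catW: "categorical X B F (W i)" if i: "i \<le> n" "W i \<noteq> {}" for i
      proof -
        obtain D where D: "stratum_preserving_deformation X F (W i) D"
          "\<And>x. D (x, 1) = K (G i (x, 1), 1)"
          using concatenate_deformations[OF G[rule_format, OF i(1)] K(1)] unfolding W_def by auto
        have "\<forall>x\<in>W i. D (x, 1) \<in> B"
          using D(2) K(2) by (auto simp: W_def)
        then show ?thesis
          unfolding categorical_iff using D(1) i by (auto simp: W_def)
      qed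
      \<comment> \<open>Categorical sets are nonempty, so an empty \<open>W i\<close> is replaced by a nonempty \<open>W j\<close>. One
        exists because \<open>X\<close> contains the nonempty set \<open>U\<close>.\<close>
      obtain j where j: "j \<le> n" "W j \<noteq> {}"
        using cover U(3,4) by fastforce
      define V where "V i = (if W i = {} then W j else W i)" for i
      have "topspace X = (\<Union>i\<le>n. V i)"
      proof
        show "topspace X \<subseteq> (\<Union>i\<le>n. V i)"
          unfolding cover V_def by auto
        show "(\<Union>i\<le>n. V i) \<subseteq> topspace X"
          unfolding V_def W_def by auto
      qed
      then show ?thesis
        using opW catW j by (intro exI[of _ V]) (auto simp: V_def)
    qed
    then show "Ocat X B F \<le> Whcat X A F"
      unfolding Whcat_def Ocat_def whitehead_iff by (intro Inf_superset_mono image_mono) blast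
  }
qed

end
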